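(* Let $S$ be a reduced (multiplicative) commutative semigroup with $0$ and identity $1\neq 0$, and let $\le$ be the partial order on $S$ given by: $r\le s$ if and only if either $ann(s)\subsetneqq ann(r)$, or $ann(r)=ann(s)$ and $r\le s$ in some predetermined well-order on the set $[r]=\{x\in S: ann(x)=ann(r)\}$. If $S$ satisfies the annihilator condition (a.c.), then the following statements are equivalent. (1) The meet-semilattice $(S,\le)$ is quasi-complemented. (2) For any $x\in S$, there exists $y\in S$ such that $x^{\perp}=y^{\perp\perp}$. (3) For every $x\in S$, there exists $y\in x^{\perp}$ such that $x^{\perp}\cap y^{\perp}=\{0\}$. (4) For every $x\in S$, there exists $y\in x^{\perp}$ such that $\overline{\mathrm{int}(V(x))}=\overline{D(y)}$ (interior and closure in $Spec(S)$). (5) For every $x\in S$, there exists $y\in S$ such that $V'(y)=V'(x^{\perp})$. (6) $\Gamma(S)$ is complemented. (7) $\Gamma(S)$ is uniquely complemented. (8) $G(S)$ is complemented. (9) $G(S)$ is uniquely complemented. (10) The meet-semilattice $(S,\le)$ is weakly quasi-complemented.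
   Context: Semigroup notions: $S$ is reduced if it has no non-zero nilpotent elements. $ann(s)=\{x\in S: xs=0\}$. $S$ satisfies a.c. if for all $x,y\in S$ there is $z\in S$ with $ann(x)\cap ann(y)=ann(z)$. $G(S)$ is the simple graph with vertices the $x\in S\setminus\{0\}$ such that $xy=0$ for some $y\in S\setminus\{0\}$, distinct vertices $a,b$ being adjacent iff $ab=0$. Order notions, applied to the poset $(S,\le)$ with least element $0$: For $A\subseteq S$, $A^u$ and $A^\ell$ are the sets of upper and lower bounds of $A$, and $A^{u\ell}=(A^u)^\ell$. For non-empty $A$, $A^\perp=\{y: \{x,y\}^\ell=\{0\}\ \forall x\in A\}$, $x^\perp=\{x\}^\perp$, $x^{\perp\perp}=(x^\perp)^\perp$. An ideal is a non-empty $I\subseteq S$ such that $a,b\in I$ implies $\{a,b\}^{u\ell}\subseteq I$; $(x]=\{z: z\le x\}$; $\vee$ of ideals is the join in the lattice of all ideals under inclusion. A proper ideal $I$ is prime if $\{x,y\}^\ell\subseteq I$ implies $x\in I$ or $y\in I$. $Spec(S)$ is the set of prime ideals and $Min(S)$ the set of its minimal elements under inclusion. $V(a)=\{P\in Spec(S): a\in P\}$, $D(a)=Spec(S)\setminus V(a)$; $Spec(S)$ has the Zariski topology, whose closed sets are $V(I)=\bigcap_{a\in I}V(a)$ for ideals $I$. $V'(a)=V(a)\cap Min(S)$ and $V'(x^\perp)=\{P\in Min(S): x^\perp\subseteq P\}$. A poset with $0$ is quasi-complemented if for any $x$ there is $y\neq x$ with $\{x,y\}^\ell=\{0\}$ and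 $((x]\vee(y])^\perp=\{0\}$; it is weakly quasi-complemented if for any $x$ there are finitely many $y_1,\dots,y_n$ distinct from $x$ with $x^{\perp\perp}=\bigcap_{i=1}^n y_i^\perp$. $\Gamma(S)$ is the simple graph whose vertices are the non-zero $x$ for which there is $y\ne0$ with $\{x,y\}^\ell=\{0\}$, distinct $x,y$ being adjacent iff $\{x,y\}^\ell=\{0\}$. Graph notions: for distinct vertices $a,b$ of a graph $G$ write $a\bot b$ if $a,b$ are adjacent and no vertex is adjacent to both. $G$ is complemented if each vertex $a$ has a vertex $b$ with $a\bot b$; uniquely complemented if it is complemented and whenever $a\bot b$ and $a\bot c$, then $b$ and $c$ are adjacent to exactly the same vertices. *)

theory Defs
  imports "HOL-Analysis.Abstract_Topology"
begin

definition all_equivalent :: "bool list \<Rightarrow> bool" where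
  "all_equivalent Ps \<longleftrightarrow> (\<forall>P\<in>set Ps. \<forall>Q\<in>set Ps. P \<longleftrightarrow> Q)"

section \<open>Semigroups with zero\<close>

text \<open>
  A commutative semigroup with \<open>0\<close> and identity \<open>1 \<noteq> 0\<close> is a type of sort
  \<open>{comm_monoid_mult, mult_zero, zero_neq_one}\<close>; there is no addition.
\<close>

definition ann :: "'a::{times,zero} \<Rightarrow> 'a set" where
  "ann s = {x. x * s = 0}"

definition ann_class :: "'a::{times,zero} \<Rightarrow> 'a set" where
  "ann_class r = {x. ann x = ann r}"

text \<open>
  The argument \<open>W\<close> supplies the predetermined well-orders, indexed by the classes themselves, so
  that elements of the same class are compared by the same well-order.
\<close>

definition ann_order :: "('a::{times,zero} set \<Rightarrow> 'a rel) \<Rightarrow> 'a rel" where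
  "ann_order W = {(r, s). ann s \<subset> ann r \<or> (ann r = ann s \<and> (r, s) \<in> W (ann_class r))}"

section \<open>Simple graphs\<close>

text \<open>A simple graph is given by its vertex set \<open>V\<close> and an irreflexive symmetric \<open>E \<subseteq> V \<times> V\<close>.\<close>

definition graph_perp :: "'a set \<Rightarrow> 'a rel \<Rightarrow> 'a \<Rightarrow> 'a \<Rightarrow> bool" where
  "graph_perp V E a b \<longleftrightarrow> a \<in> V \<and> b \<in> V \<and> a \<noteq> b \<and> (a, b) \<in> E \<and>
     \<not> (\<exists>c\<in>V. (c, a) \<in> E \<and> (c, b) \<in> E)"

definition graph_complemented :: "'a set \<Rightarrow> 'a rel \<Rightarrow> bool" where
  "graph_complemented V E \<longleftrightarrow> (\<forall>a\<in>V. \<exists>b\<in>V. graph_perp V E a b)"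

definition graph_uniquely_complemented :: "'a set \<Rightarrow> 'a rel \<Rightarrow> bool" where
  "graph_uniquely_complemented V E \<longleftrightarrow> graph_complemented V E \<and>
     (\<forall>a b c. graph_perp V E a b \<and> graph_perp V E a c \<longrightarrow>
        (\<forall>v\<in>V. (v, b) \<in> E \<longleftrightarrow> (v, c) \<in> E))"

definition G_verts :: "'a::{times,zero} set" where
  "G_verts = {x. x \<noteq> 0 \<and> (\<exists>y. y \<noteq> 0 \<and> x * y = 0)}"

definition G_edges :: "'a::{times,zero} rel" where
  "G_edges = {(a, b). a \<in> G_verts \<and> b \<in> G_verts \<and> a \<noteq> b \<and> a * b = 0}"

section \<open>Posets with least element zero\<close>

text \<open>
  A poset is given by its order relation \<open>r\<close>, with carrier \<open>Field r\<close>; its least element is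
  \<open>0\<close>.  With the notions of \<open>HOL.Order_Relation\<close>, \<^term>\<open>Above r A\<close> is \<open>A\<^sup>u\<close>, \<^term>\<open>Under r A\<close> is
  \<open>A\<^sup>l\<close> and \<^term>\<open>under r x\<close> is the principal ideal \<open>(x]\<close>.
\<close>

definition perp :: "'a::zero rel \<Rightarrow> 'a set \<Rightarrow> 'a set" where
  "perp r A = {y \<in> Field r. \<forall>x\<in>A. Under r {x, y} = {0}}"

definition poset_ideal :: "'a rel \<Rightarrow> 'a set \<Rightarrow> bool" where
  "poset_ideal r I \<longleftrightarrow> I \<noteq> {} \<and> I \<subseteq> Field r \<and> (\<forall>a\<in>I. \<forall>b\<in>I. Under r (Above r {a, b}) \<subseteq> I)"

definition ideal_join :: "'a rel \<Rightarrow> 'a set \<Rightarrow> 'a set \<Rightarrow> 'a set" where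
  "ideal_join r I J = (LEAST K. poset_ideal r K \<and> I \<subseteq> K \<and> J \<subseteq> K)"

definition prime_ideal :: "'a rel \<Rightarrow> 'a set \<Rightarrow> bool" where
  "prime_ideal r P \<longleftrightarrow> poset_ideal r P \<and> P \<noteq> Field r \<and>
     (\<forall>x\<in>Field r. \<forall>y\<in>Field r. Under r {x, y} \<subseteq> P \<longrightarrow> x \<in> P \<or> y \<in> P)"

definition Spec :: "'a rel \<Rightarrow> 'a set set" where
  "Spec r = {P. prime_ideal r P}"

definition MinSpec :: "'a rel \<Rightarrow> 'a set set" where
  "MinSpec r = {P \<in> Spec r. \<forall>Q\<in>Spec r. Q \<subseteq> P \<longrightarrow> Q = P}"

definition V :: "'a rel \<Rightarrow> 'a \<Rightarrow> 'a set set" where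
  "V r a = {P \<in> Spec r. a \<in> P}"

definition D :: "'a rel \<Rightarrow> 'a \<Rightarrow> 'a set set" where
  "D r a = Spec r - V r a"

definition V_ideal :: "'a rel \<Rightarrow> 'a set \<Rightarrow> 'a set set" where
  "V_ideal r I = (\<Inter>a\<in>I. V r a)"

definition zariski :: "'a rel \<Rightarrow> 'a set topology" where
  "zariski r = topology (\<lambda>U. \<exists>I. poset_ideal r I \<and> U = Spec r - V_ideal r I)"

definition V_min :: "'a rel \<Rightarrow> 'a \<Rightarrow> 'a set set" where
  "V_min r a = V r a \<inter> MinSpec r"

definition V_min_perp :: "'a::zero rel \<Rightarrow> 'a \<Rightarrow> 'a set set" where
  "V_min_perp r x = {P \<in> MinSpec r. perp r {x} \<subseteq> P}"

text \<open>
  Both complementation properties make sense in any poset with \<open>0\<close>; existence of binary meets is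
  not part of them.
\<close>

definition quasi_complemented :: "'a::zero rel \<Rightarrow> bool" where
  "quasi_complemented r \<longleftrightarrow>
     (\<forall>x\<in>Field r. \<exists>y\<in>Field r. y \<noteq> x \<and> Under r {x, y} = {0} \<and>
        perp r (ideal_join r (under r x) (under r y)) = {0})"

definition weakly_quasi_complemented :: "'a::zero rel \<Rightarrow> bool" where
  "weakly_quasi_complemented r \<longleftrightarrow>
     (\<forall>x\<in>Field r. \<exists>Y. finite Y \<and> Y \<noteq> {} \<and> Y \<subseteq> Field r - {x} \<and>
        perp r (perp r {x}) = (\<Inter>y\<in>Y. perp r {y}))"

definition Gamma_verts :: "'a::zero rel \<Rightarrow> 'a set" where
  "Gamma_verts r = {x \<in> Field r. x \<noteq> 0 \<and> (\<exists>y\<in>Field r. y \<noteq> 0 \<and> Under r {x, y} = {0})}"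

definition Gamma_edges :: "'a::zero rel \<Rightarrow> 'a rel" where
  "Gamma_edges r = {(x, y). x \<in> Gamma_verts r \<and> y \<in> Gamma_verts r \<and> x \<noteq> y \<and> Under r {x, y} = {0}}"

section \<open>The definitions are meaningful\<close>

lemma ann_order_partial_order:
  assumes "\<And>r. well_order_on (ann_class r) (W (ann_class r))"
  shows "partial_order_on UNIV (ann_order W)"
proof -
  have cls: "ann_class x = ann_class y" if "ann x = ann y" for x y :: 'a
    using that by (simp add: ann_class_def)
  have lin: "linear_order_on (ann_class x) (W (ann_class x))" for x
    using assms[of x] by (simp add: well_order_on_def)
  have r: "(x, x) \<in> W (ann_class x)" for x
    using lin[of x] by (auto simp: order_on_defs refl_on_def ann_class_def)
  have t: "(x, z) \<in> W c" if "(x, y) \<in> W c" "(y, z) \<in> W c" "c = ann_class x" for x y z c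
    using lin[of x] that by (auto simp: order_on_defs dest: transD)
  have a: "x = y" if "(x, y) \<in> W c" "(y, x) \<in> W c" "c = ann_class x" for x y c
    using lin[of x] that by (auto simp: order_on_defs dest: antisymD)
  show ?thesis
    unfolding partial_order_on_def preorder_on_def
  proof (intro conjI)
    show "refl (ann_order W)"
      using r by (simp add: refl_on_def ann_order_def)
    show "trans (ann_order W)"
    proof (rule transI)
      fix x y z assume xy: "(x, y) \<in> ann_order W" and yz: "(y, z) \<in> ann_order W"
      show "(x, z) \<in> ann_order W"
      proof (cases "ann x = ann y \<and> ann y = ann z")
        case True
        with xy yz have "(x, y) \<in> W (ann_class x)" "(y, z) \<in> W (ann_class x)"
          using cls[of x y] by (simp_all add: ann_order_def)
        with t[of x y "ann_class x" z] True show ?thesis by (simp add: ann_order_def)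
      next
        case False
        with xy yz have "ann z \<subset> ann x" unfolding ann_order_def by auto
        then show ?thesis by (simp add: ann_order_def)
      qed
    qed
    show "antisym (ann_order W)"
    proof (rule antisymI)
      fix x y assume xy: "(x, y) \<in> ann_order W" and yx: "(y, x) \<in> ann_order W"
      then have "ann x = ann y" unfolding ann_order_def by auto
      with xy yx have "(x, y) \<in> W (ann_class x)" "(y, x) \<in> W (ann_class x)"
        using cls[of x y] by (simp_all add: ann_order_def)
      with a show "x = y" by blast
    qed
  qed auto
qed

lemma Field_ann_order:
  assumes "\<And>r. well_order_on (ann_class r) (W (ann_class r))"
  shows "Field (ann_order W) = UNIV"
  using ann_order_partial_order[OF assms]
  by (auto simp: order_on_defs refl_on_def Field_def)

lemma ann_order_zero_least:
  fixes s :: "'a::{comm_monoid_mult,mult_zero}"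
  assumes "\<And>r. well_order_on (ann_class r) (W (ann_class r))"
  shows "(0, s) \<in> ann_order W"
proof (cases "ann s = (UNIV :: 'a set)")
  case True
  then have "1 * s = 0" unfolding ann_def by blast
  then have "s = 0" by simp
  then show ?thesis
    using ann_order_partial_order[OF assms] by (auto simp: order_on_defs refl_on_def)
next
  case False
  then show ?thesis by (auto simp: ann_order_def ann_def)
qed

lemma poset_ideal_Inter:
  assumes "\<And>I. I \<in> \<I> \<Longrightarrow> poset_ideal r I" "\<I> \<noteq> {}" "\<Inter>\<I> \<noteq> {}"
  shows "poset_ideal r (\<Inter>\<I>)"
  unfolding poset_ideal_def
proof (intro conjI ballI)
  show "\<Inter>\<I> \<subseteq> Field r" using assms(1,2) unfolding poset_ideal_def by blast
  fix a b assume ab: "a \<in> \<Inter>\<I>" "b \<in> \<Inter>\<I>"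
  show "Under r (Above r {a, b}) \<subseteq> \<Inter>\<I>"
  proof (rule Inter_greatest)
    fix I assume "I \<in> \<I>"
    with assms(1) ab show "Under r (Above r {a, b}) \<subseteq> I" unfolding poset_ideal_def by blast
  qed
qed (fact assms(3))

lemma poset_ideal_Field: "Field r \<noteq> {} \<Longrightarrow> poset_ideal r (Field r)"
  by (auto simp: poset_ideal_def Under_def)

lemma ideal_join_eq_Inter:
  assumes "I \<noteq> {}" "I \<subseteq> Field r" "J \<subseteq> Field r"
  shows "ideal_join r I J = \<Inter>{K. poset_ideal r K \<and> I \<subseteq> K \<and> J \<subseteq> K}" (is "_ = \<Inter>?C")
  unfolding ideal_join_def
proof (rule Least_equality)
  have "Field r \<in> ?C" using assms by (auto intro: poset_ideal_Field)
  moreover have "\<Inter>?C \<noteq> {}" using assms(1) by blast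
  ultimately have "poset_ideal r (\<Inter>?C)" by (intro poset_ideal_Inter) auto
  then show "poset_ideal r (\<Inter>?C) \<and> I \<subseteq> \<Inter>?C \<and> J \<subseteq> \<Inter>?C" by blast
qed blast

lemma poset_ideal_zero:
  assumes "partial_order_on (Field r) r" "\<And>x. x \<in> Field r \<Longrightarrow> (0, x) \<in> r" "0 \<in> Field r"
  shows "poset_ideal r {0}"
proof -
  have "Above r {0, 0} = Field r" using assms(2) by (auto simp: Above_def)
  moreover have "Under r (Field r) \<subseteq> {0}"
    using assms by (auto simp: Under_def order_on_defs dest: antisymD)
  ultimately show ?thesis using assms(3) by (simp add: poset_ideal_def)
qed

lemma poset_ideal_down:
  assumes "partial_order_on (Field r) r" "poset_ideal r I" "a \<in> I" "(b, a) \<in> r"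
  shows "b \<in> I"
proof -
  have "b \<in> Under r (Above r {a, a})"
    using assms(1,4) by (auto simp: Under_def Above_def order_on_defs Field_def dest: transD)
  with assms(2,3) show ?thesis unfolding poset_ideal_def by blast
qed

lemma V_ideal_eq: "I \<noteq> {} \<Longrightarrow> V_ideal r I = {P \<in> Spec r. I \<subseteq> P}"
  by (auto simp: V_ideal_def V_def)

lemma istopology_zariski:
  assumes po: "partial_order_on (Field r) r"
    and least: "\<And>x. x \<in> Field r \<Longrightarrow> (0, x) \<in> r" and zero: "0 \<in> Field r"
  shows "istopology (\<lambda>U. \<exists>I. poset_ideal r I \<and> U = Spec r - V_ideal r I)"
proof -
  have zI: "0 \<in> I" if "poset_ideal r I" for I
    using poset_ideal_down[OF po that] least that unfolding poset_ideal_def by blast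
  have V: "V_ideal r I = {P \<in> Spec r. I \<subseteq> P}" if "poset_ideal r I" for I
    using that by (intro V_ideal_eq) (simp add: poset_ideal_def)
  show ?thesis
    unfolding istopology_def
  proof (intro conjI allI impI)
    fix S T assume "\<exists>I. poset_ideal r I \<and> S = Spec r - V_ideal r I"
      and "\<exists>I. poset_ideal r I \<and> T = Spec r - V_ideal r I"
    then obtain I J where I: "poset_ideal r I" "S = Spec r - V_ideal r I"
      and J: "poset_ideal r J" "T = Spec r - V_ideal r J" by blast
    have IJ: "poset_ideal r (I \<inter> J)"
      using poset_ideal_Inter[of "{I, J}" r] I J zI by auto
    have "I \<subseteq> P \<or> J \<subseteq> P" if P: "P \<in> Spec r" and sub: "I \<inter> J \<subseteq> P" for P
    proof (rule ccontr)
      assume "\<not> ?thesis"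
      then obtain x y where xy: "x \<in> I" "x \<notin> P" "y \<in> J" "y \<notin> P" by blast
      have "Under r {x, y} \<subseteq> I \<inter> J"
        using poset_ideal_down[OF po I(1) xy(1)] poset_ideal_down[OF po J(1) xy(3)]
        by (auto simp: Under_def)
      with sub have "Under r {x, y} \<subseteq> P" by blast
      moreover have "x \<in> Field r" "y \<in> Field r"
        using xy I(1) J(1) by (auto simp: poset_ideal_def)
      ultimately show False
        using P xy(2,4) by (auto simp: Spec_def prime_ideal_def)
    qed
    then have "S \<inter> T = Spec r - V_ideal r (I \<inter> J)"
      unfolding I(2) J(2) V[OF I(1)] V[OF J(1)] V[OF IJ] by blast
    with IJ show "\<exists>K. poset_ideal r K \<and> S \<inter> T = Spec r - V_ideal r K" by blast
  next
    fix \<K> assume K: "\<forall>U\<in>\<K>. \<exists>I. poset_ideal r I \<and> U = Spec r - V_ideal r I"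
    define \<I> where "\<I> = {I. poset_ideal r I \<and> Spec r - V_ideal r I \<in> \<K>}"
    define J where "J = \<Inter>{K. poset_ideal r K \<and> (\<forall>I\<in>\<I>. I \<subseteq> K)}"
    have F: "poset_ideal r (Field r)" using zero by (intro poset_ideal_Field) auto
    have J: "poset_ideal r J"
      unfolding J_def
    proof (rule poset_ideal_Inter)
      have "I \<subseteq> Field r" if "I \<in> \<I>" for I
        using that by (simp add: \<I>_def poset_ideal_def)
      with F show "{K. poset_ideal r K \<and> (\<forall>I\<in>\<I>. I \<subseteq> K)} \<noteq> {}" by blast
      show "\<Inter>{K. poset_ideal r K \<and> (\<forall>I\<in>\<I>. I \<subseteq> K)} \<noteq> {}" using zI by blast
    qed simp
    have JP: "J \<subseteq> P \<longleftrightarrow> (\<forall>I\<in>\<I>. I \<subseteq> P)" if "P \<in> Spec r" for P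
    proof
      have "I \<subseteq> J" if "I \<in> \<I>" for I
        unfolding J_def using that by (intro Inter_greatest) simp
      then show "\<forall>I\<in>\<I>. I \<subseteq> P" if "J \<subseteq> P" using that by (meson order_trans)
      have "poset_ideal r P" using \<open>P \<in> Spec r\<close> by (simp add: Spec_def prime_ideal_def)
      then show "J \<subseteq> P" if "\<forall>I\<in>\<I>. I \<subseteq> P"
        unfolding J_def using that by (intro Inter_lower) simp
    qed
    have "\<K> = (\<lambda>I. Spec r - V_ideal r I) ` \<I>"
      using K by (auto simp: \<I>_def)
    moreover have "V_ideal r I = {P \<in> Spec r. I \<subseteq> P}" if "I \<in> \<I>" for I
      using that V by (simp add: \<I>_def)
    ultimately have "\<Union>\<K> = {P \<in> Spec r. \<not> (\<forall>I\<in>\<I>. I \<subseteq> P)}" by auto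
    also have "\<dots> = Spec r - V_ideal r J"
      using JP unfolding V[OF J] by auto
    finally show "\<exists>I. poset_ideal r I \<and> \<Union>\<K> = Spec r - V_ideal r I"
      using J by blast
  qed
qed

lemma
  assumes po: "partial_order_on (Field r) r"
    and least: "\<And>x. x \<in> Field r \<Longrightarrow> (0, x) \<in> r" and zero: "0 \<in> Field r"
  shows topspace_zariski: "topspace (zariski r) = Spec r"
    and closedin_zariski: "closedin (zariski r) C \<longleftrightarrow> (\<exists>I. poset_ideal r I \<and> C = V_ideal r I)"
proof -
  have op: "openin (zariski r) U \<longleftrightarrow> (\<exists>I. poset_ideal r I \<and> U = Spec r - V_ideal r I)" for U
    unfolding zariski_def using istopology_zariski[OF po least zero] by (simp add: topology_inverse')
  have F: "poset_ideal r (Field r)" using zero by (intro poset_ideal_Field) auto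
  have "V_ideal r (Field r) = {}"
    using zero by (subst V_ideal_eq) (auto simp: Spec_def prime_ideal_def poset_ideal_def)
  with F have "openin (zariski r) (Spec r)" unfolding op by (metis Diff_empty)
  then show ts: "topspace (zariski r) = Spec r"
    unfolding topspace_def op by blast
  have "V_ideal r I \<subseteq> Spec r" if "poset_ideal r I" for I
    using that by (auto simp: V_ideal_def V_def poset_ideal_def)
  then show "closedin (zariski r) C \<longleftrightarrow> (\<exists>I. poset_ideal r I \<and> C = V_ideal r I)"
    unfolding closedin_def ts op by (metis double_diff order_refl Diff_subset)
qed

end

theory Submission
  imports Defs
begin

text \<open>
  In the order of the statement, \<open>{x, y}\<^sup>l = {0}\<close> holds iff \<open>x y = 0\<close>, so \<open>x\<^sup>\<bottom> = ann x\<close> and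
  \<open>\<Gamma>(S) = G(S)\<close>.  Call \<open>y\<close> a complement of \<open>x\<close> if \<open>x y = 0\<close> and \<open>ann x \<inter> ann y = 0\<close>; each of the
  ten conditions says that every \<open>x\<close> has a complement.

  For the join and for (10) the point is that, by the annihilator condition, annihilators are ideals
  and finite intersections of annihilators are annihilators.  For (4) and (5) one needs enough
  minimal primes: a maximal multiplicatively closed set avoiding \<open>0\<close> has as its complement a directed
  union of annihilators, which is a minimal prime ideal, and every minimal prime \<open>P\<close> arises in this
  way.  Hence \<open>x \<in> P\<close> iff \<open>ann x\<close> is not contained in \<open>P\<close>, and the minimal primes intersect in \<open>0\<close>.
\<close>

section \<open>Annihilators in reduced semigroups\<close>

text \<open>The interface to the order: it refines reverse inclusion of annihilators and is total
  among elements with equal annihilators.\<close>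

locale reduced_semigroup_order =
  fixes R :: "'a::{comm_monoid_mult,mult_zero,zero_neq_one} rel"
  assumes square_zero: "\<And>x::'a. x * x = 0 \<Longrightarrow> x = 0"
    and ac: "\<And>x y::'a. \<exists>z. ann x \<inter> ann y = ann z"
    and partial_order: "partial_order_on UNIV R"
    and order_ann: "\<And>x y. (x, y) \<in> R \<Longrightarrow> ann y \<subseteq> ann x"
    and strict_ann_order: "\<And>x y. ann y \<subset> ann x \<Longrightarrow> (x, y) \<in> R"
    and same_ann_order: "\<And>x y. ann x = ann y \<Longrightarrow> (x, y) \<in> R \<or> (y, x) \<in> R"
begin

lemma square_zero_iff: "x * x = 0 \<longleftrightarrow> x = (0 :: 'a)"
  by (metis square_zero mult_zero_left)

lemma mem_ann: "x \<in> ann y \<longleftrightarrow> x * y = (0 :: 'a)"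
  by (simp add: ann_def)

lemma mem_ann_comm: "x \<in> ann y \<longleftrightarrow> y \<in> ann (x :: 'a)"
  by (simp add: mem_ann mult.commute)

lemma zero_in_ann: "0 \<in> ann (x :: 'a)"
  by (simp add: mem_ann)

lemma ann_zero: "ann 0 = (UNIV :: 'a set)"
  by (simp add: ann_def)

lemma ann_UNIV_imp_zero: "ann x = UNIV \<Longrightarrow> x = (0 :: 'a)"
  using mem_ann[of 1 x] by simp

lemma ann_subset_ann_mult: "ann x \<union> ann y \<subseteq> ann (x * y :: 'a)"
  by (auto simp: mem_ann ac_simps) (metis mult.assoc mult.commute mult_zero_left)+

text \<open>Reducedness enters here: chasing \<open>w\<close> through both inclusions gives
  \<open>w * z * z = 0\<close>, so \<open>w * z\<close> squares to zero. Up to annihilators, the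
  product thus acts as a meet.\<close>

lemma ann_mult_subset:
  assumes "ann x \<subseteq> ann z" "ann y \<subseteq> ann (z :: 'a)"
  shows "ann (x * y) \<subseteq> ann z"
proof
  fix w assume "w \<in> ann (x * y)"
  then have "w * x \<in> ann y" by (simp add: mem_ann mult.assoc)
  with assms(2) have "w * x * z = 0" by (auto simp: mem_ann)
  then have "w * z \<in> ann x" by (simp add: mem_ann ac_simps)
  with assms(1) have "w * z * z = 0" by (auto simp: mem_ann)
  then have "w * z * (w * z) = 0"
    by (metis mult.assoc mult.commute mult_zero_left)
  then show "w \<in> ann z" by (simp add: square_zero_iff mem_ann)
qed

section \<open>Orthogonality and ideals in the order\<close>

lemma Field_R: "Field R = UNIV"
  using partial_order by (auto simp: order_on_defs refl_on_def Field_def)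

lemma partial_order_Field: "partial_order_on (Field R) R"
  using partial_order by (simp add: Field_R)

lemma R_refl: "(x, x) \<in> R"
  using partial_order by (simp add: order_on_defs refl_on_def)

lemma zero_least: "(0, x) \<in> R"
proof (cases "ann x = UNIV")
  case True
  then show ?thesis using ann_UNIV_imp_zero R_refl by blast
next
  case False
  then show ?thesis by (intro strict_ann_order) (auto simp: ann_zero)
qed

text \<open>The product itself need not be a lower bound when it has the same annihilator as a factor.\<close>

lemma factor_or_mult_in_Under: "\<exists>z\<in>{x, y, x * y}. z \<in> Under R {x, y}"
proof -
  \<comment> \<open>If \<open>ann (x * y)\<close> equals \<open>ann x\<close> or
    \<open>ann y\<close>, these two are comparable and a factor is a lower bound; otherwise both
    inclusions are strict and the product is one.\<close>
  consider "ann x = ann y" | "ann x \<subset> ann y" | "ann y \<subset> ann x"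
    | "ann x \<subset> ann (x * y)" "ann y \<subset> ann (x * y)"
    using ann_subset_ann_mult[of x y] by blast
  then show ?thesis
    using R_refl same_ann_order[of x y] strict_ann_order
    by cases (auto simp: Under_def Field_R)
qed

text \<open>The annihilator of a lower bound contains \<open>ann x\<close> and \<open>ann y\<close>,
  hence \<open>ann (x * y)\<close>; if the product is zero, so is the bound. Conversely, one of
  \<open>x\<close>, \<open>y\<close>, \<open>x * y\<close> is a lower bound, and if it is zero the
  product is too.\<close>

lemma Under_eq_zero: "Under R {x, y} = {0} \<longleftrightarrow> x * y = 0"
proof
  assume "x * y = 0"
  have "z = 0" if "z \<in> Under R {x, y}" for z
  proof -
    have "ann x \<subseteq> ann z" "ann y \<subseteq> ann z"
      using that order_ann by (auto simp: Under_def)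
    with ann_mult_subset \<open>x * y = 0\<close> have "ann 0 \<subseteq> ann z" by metis
    then show ?thesis using ann_UNIV_imp_zero by (auto simp: ann_zero)
  qed
  then show "Under R {x, y} = {0}"
    using zero_least by (auto simp: Under_def Field_R)
next
  assume "Under R {x, y} = {0}"
  with factor_or_mult_in_Under[of x y] show "x * y = 0" by fastforce
qed

lemma perp_eq: "perp R A = {y. \<forall>x\<in>A. x * y = 0}"
  by (simp add: perp_def Field_R Under_eq_zero)

lemma perp_singleton: "perp R {x} = ann x"
  by (auto simp: perp_eq mem_ann mult.commute)

text \<open>The annihilator condition yields an upper bound \<open>c\<close> of \<open>a\<close> and
  \<open>b\<close> killed by whatever kills both, in particular by \<open>z\<close>; then
  \<open>z\<close> kills everything below \<open>c\<close>.\<close>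

lemma poset_ideal_ann: "poset_ideal R (ann z)"
  unfolding poset_ideal_def
proof (intro conjI ballI)
  show "ann z \<noteq> {}" using zero_in_ann by blast
  show "ann z \<subseteq> Field R" by (simp add: Field_R)
  fix a b assume ab: "a \<in> ann z" "b \<in> ann z"
  obtain d where d: "ann a \<inter> ann b = ann d" using ac by blast
  have "\<exists>c. c \<in> Above R {a, b} \<and> ann a \<inter> ann b \<subseteq> ann c"
  proof -
    \<comment> \<open>The witness \<open>d\<close> is used as upper bound when both inclusions are
      strict; otherwise \<open>ann a\<close> and \<open>ann b\<close> are comparable and
      \<open>a\<close> or \<open>b\<close> serves.\<close>
    consider "ann a = ann b" | "ann a \<subset> ann b" | "ann b \<subset> ann a"
      | "ann d \<subset> ann a" "ann d \<subset> ann b"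
      using d by blast
    then show ?thesis
    proof cases
      case 1
      then show ?thesis using same_ann_order[of a b] R_refl
        by (auto simp: Above_def Field_R)
    next
      case 2
      then show ?thesis using strict_ann_order[of a b] R_refl
        by (intro exI[of _ a]) (auto simp: Above_def Field_R strict_ann_order)
    next
      case 3
      then show ?thesis using R_refl
        by (intro exI[of _ b]) (auto simp: Above_def Field_R strict_ann_order)
    next
      case 4
      with d show ?thesis
        by (intro exI[of _ d]) (auto simp: Above_def Field_R strict_ann_order)
    qed
  qed
  then obtain c where c: "c \<in> Above R {a, b}" "ann a \<inter> ann b \<subseteq> ann c" by blast
  have "z \<in> ann c" using ab c(2) by (auto simp: mem_ann mult.commute)
  moreover have "ann c \<subseteq> ann w" if "w \<in> Under R (Above R {a, b})" for w
    using that c(1) order_ann by (auto simp: Under_def)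
  ultimately show "Under R (Above R {a, b}) \<subseteq> ann z"
    using mem_ann_comm by blast
qed

lemma poset_ideal_under: "poset_ideal R (under R a)"
  using R_refl by (auto simp: poset_ideal_def under_def Above_def Under_def Field_R)

lemma ann_finite_Inter:
  assumes "finite Y"
  shows "\<exists>z::'a. (\<Inter>y\<in>Y. ann y) = ann z"
  using assms
proof (induction Y)
  case empty
  then show ?case using ann_zero by auto
next
  case (insert x F)
  then show ?case using ac by fastforce
qed

section \<open>Complements\<close>

definition ann_compl :: "'a \<Rightarrow> 'a \<Rightarrow> bool" where
  "ann_compl x y \<longleftrightarrow> x * y = 0 \<and> ann x \<inter> ann y = {0}"

lemma ann_compl_sym: "ann_compl x y \<Longrightarrow> ann_compl y x"
  by (auto simp: ann_compl_def mult.commute)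

text \<open>A self-complementary element would square to zero, hence be \<open>0\<close>, whose
  annihilator contains \<open>1\<close>. This settles the distinctness clauses in the order and
  graph conditions.\<close>

lemma ann_compl_neq: "ann_compl x y \<Longrightarrow> x \<noteq> y"
  using ann_zero square_zero[of x] zero_neq_one[where 'a='a]
  by (metis UNIV_I ann_compl_def inf_idem singletonD)

text \<open>For a complement, products of elements of \<open>ann x\<close> and \<open>ann y\<close>
  lie in both annihilators, so they vanish. Conversely, \<open>y\<close> kills \<open>ann y\<close>,
  hence \<open>y\<close> kills \<open>x\<close>; a common annihilator kills itself.\<close>

lemma ann_compl_iff_perp: "ann_compl x y \<longleftrightarrow> ann x = perp R (ann y)"
proof
  assume c: "ann_compl x y"
  have "z * w = 0" if "z \<in> ann x" "w \<in> ann y" for z w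
  proof -
    have "z * w \<in> ann x \<inter> ann y"
      using that ann_subset_ann_mult[of z w] by (auto simp: mem_ann_comm)
    with c show ?thesis by (simp add: ann_compl_def)
  qed
  with c show "ann x = perp R (ann y)"
    by (auto simp: perp_eq mem_ann ann_compl_def mult.commute)
next
  assume "ann x = perp R (ann y)"
  then have eq: "z * x = 0 \<longleftrightarrow> (\<forall>w\<in>ann y. w * z = 0)" for z
    by (auto simp: perp_eq ann_def)
  have "x * y = 0" using eq[of y] by (simp add: mem_ann mult.commute)
  moreover have "z = 0" if "z \<in> ann x" "z \<in> ann y" for z
    using eq[of z] that by (metis mem_ann square_zero)
  ultimately show "ann_compl x y"
    using zero_in_ann by (auto simp: ann_compl_def)
qed

text \<open>If \<open>z\<close> kills \<open>x\<close> and \<open>y\<close>, then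
  \<open>ann z\<close> is an ideal containing both principal ideals, hence their join.\<close>

lemma perp_ideal_join: "perp R (ideal_join R (under R x) (under R y)) = ann x \<inter> ann y"
proof -
  let ?J = "ideal_join R (under R x) (under R y)"
  have J: "?J = \<Inter>{K. poset_ideal R K \<and> under R x \<subseteq> K \<and> under R y \<subseteq> K}"
    using R_refl by (intro ideal_join_eq_Inter) (auto simp: Field_R under_def)
  have "x \<in> ?J" "y \<in> ?J" unfolding J using R_refl by (auto simp: under_def)
  then have "perp R ?J \<subseteq> ann x \<inter> ann y" by (auto simp: perp_eq mem_ann mult.commute)
  moreover have "z \<in> perp R ?J" if z: "z \<in> ann x" "z \<in> ann y" for z
  proof -
    have "under R x \<subseteq> ann z" "under R y \<subseteq> ann z"
      using z order_ann mem_ann_comm unfolding under_def by blast+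
    then have "?J \<subseteq> ann z" unfolding J using poset_ideal_ann by blast
    then show ?thesis by (auto simp: perp_eq mem_ann)
  qed
  ultimately show ?thesis by blast
qed

lemma quasi_complemented_iff: "quasi_complemented R \<longleftrightarrow> (\<forall>x. \<exists>y. ann_compl x y)"
proof -
  have "(y \<noteq> x \<and> ann_compl x y) \<longleftrightarrow> ann_compl x y" for x y
    using ann_compl_neq[of x y] by auto
  then show ?thesis
    unfolding quasi_complemented_def Field_R Under_eq_zero perp_ideal_join
      ann_compl_def[symmetric] by simp
qed

text \<open>The finite intersection collapses to a single annihilator \<open>ann y\<close>, and
  \<open>ann y = perp R (ann x)\<close> makes \<open>y\<close> a complement. Conversely, a singleton
  \<open>Y\<close> suffices.\<close>

lemma weakly_quasi_complemented_iff:
  "weakly_quasi_complemented R \<longleftrightarrow> (\<forall>x. \<exists>y. ann_compl x y)"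
proof
  assume w: "weakly_quasi_complemented R"
  show "\<forall>x. \<exists>y. ann_compl x y"
  proof
    fix x
    obtain Y where "finite Y" "perp R (ann x) = (\<Inter>y\<in>Y. ann y)"
      using w unfolding weakly_quasi_complemented_def Field_R perp_singleton by (meson UNIV_I)
    with ann_finite_Inter obtain y where "ann y = perp R (ann x)" by metis
    then show "\<exists>y. ann_compl x y" using ann_compl_iff_perp ann_compl_sym by blast
  qed
next
  assume c: "\<forall>x. \<exists>y. ann_compl x y"
  show "weakly_quasi_complemented R"
    unfolding weakly_quasi_complemented_def perp_singleton Field_R
  proof
    fix x
    obtain y where "ann_compl x y" using c by blast
    then have "perp R (ann x) = (\<Inter>y\<in>{y}. ann y)" "x \<noteq> y"
      using ann_compl_iff_perp ann_compl_sym ann_compl_neq by auto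
    then show "\<exists>Y. finite Y \<and> Y \<noteq> {} \<and> Y \<subseteq> UNIV - {x} \<and> perp R (ann x) = (\<Inter>y\<in>Y. ann y)"
      by (intro exI[of _ "{y}"]) auto
  qed
qed

section \<open>Zero-divisor graphs\<close>

lemma Gamma_verts_eq: "Gamma_verts R = G_verts"
  by (auto simp: Gamma_verts_def G_verts_def Field_R Under_eq_zero)

lemma Gamma_edges_eq: "Gamma_edges R = G_edges"
  by (simp add: Gamma_edges_def G_edges_def Gamma_verts_eq Under_eq_zero)

text \<open>A non-zero common annihilator of \<open>a\<close> and \<open>b\<close> is a common
  neighbour: it differs from both, since otherwise it would square to zero.\<close>

lemma graph_perp_iff: "graph_perp G_verts G_edges a b \<longleftrightarrow> a \<noteq> 0 \<and> b \<noteq> 0 \<and> ann_compl a b"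
proof
  assume p: "graph_perp G_verts G_edges a b"
  then have ab: "a \<noteq> 0" "b \<noteq> 0" "a * b = 0" "a \<in> G_verts" "b \<in> G_verts"
    by (auto simp: graph_perp_def G_verts_def G_edges_def)
  have "c = 0" if c: "c * a = 0" "c * b = 0" for c
  proof (rule ccontr)
    assume "c \<noteq> 0"
    then have "c \<in> G_verts" using c ab by (auto simp: G_verts_def)
    moreover have "c \<noteq> a" "c \<noteq> b" using c \<open>c \<noteq> 0\<close> by (auto simp: square_zero_iff)
    ultimately show False
      using p c ab by (auto simp: graph_perp_def G_edges_def)
  qed
  with ab show "a \<noteq> 0 \<and> b \<noteq> 0 \<and> ann_compl a b"
    by (auto simp: ann_compl_def mem_ann)
next
  assume p: "a \<noteq> 0 \<and> b \<noteq> 0 \<and> ann_compl a b"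
  then have ab: "a * b = 0" "b * a = 0" "a \<noteq> b"
    using ann_compl_neq[of a b] by (simp_all add: ann_compl_def mult.commute)
  with p have verts: "a \<in> G_verts" "b \<in> G_verts" unfolding G_verts_def by blast+
  with ab have "(a, b) \<in> G_edges" by (simp add: G_edges_def)
  moreover have "\<not> ((c, a) \<in> G_edges \<and> (c, b) \<in> G_edges)" for c
  proof
    assume "(c, a) \<in> G_edges \<and> (c, b) \<in> G_edges"
    then have "c \<in> ann a \<inter> ann b" "c \<noteq> 0"
      by (auto simp: G_edges_def G_verts_def mem_ann)
    with p show False by (simp add: ann_compl_def)
  qed
  ultimately show "graph_perp G_verts G_edges a b"
    using verts ab(3) unfolding graph_perp_def by blast
qed

lemma ex_ann_compl_zero: "\<exists>y. ann_compl 0 y"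
  by (rule exI[of _ 1]) (auto simp: ann_compl_def ann_def)

text \<open>Non-vertices always have complements: \<open>1\<close> for \<open>0\<close>, and
  \<open>0\<close> for an element with trivial annihilator. A complement of a vertex is non-zero,
  hence again a vertex.\<close>

lemma graph_complemented_iff:
  "graph_complemented (G_verts :: 'a set) G_edges \<longleftrightarrow> (\<forall>x. \<exists>y. ann_compl x y)"
proof
  assume c: "graph_complemented (G_verts :: 'a set) G_edges"
  show "\<forall>x. \<exists>y. ann_compl x y"
  proof
    fix x :: 'a
    consider "x = 0" | "x \<in> G_verts" | "x \<noteq> 0" "x \<notin> G_verts" by blast
    then show "\<exists>y. ann_compl x y"
    proof cases
      case 1
      then show ?thesis using ex_ann_compl_zero by blast
    next
      case 2
      with c obtain y where "graph_perp G_verts G_edges x y"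
        unfolding graph_complemented_def by meson
      then have "ann_compl x y" by (simp add: graph_perp_iff)
      then show ?thesis ..
    next
      case 3
      then have "y = 0" if "x * y = 0" for y
        using that unfolding G_verts_def by blast
      then have "ann x = {0}" using zero_in_ann by (auto simp: ann_def mult.commute)
      then have "ann_compl x 0" by (simp add: ann_compl_def ann_zero)
      then show ?thesis ..
    qed
  qed
next
  assume c: "\<forall>x. \<exists>y. ann_compl x y"
  show "graph_complemented (G_verts :: 'a set) G_edges"
    unfolding graph_complemented_def
  proof
    fix a :: 'a assume a: "a \<in> G_verts"
    obtain b where b: "ann_compl a b" using c by blast
    have "b \<noteq> 0"
    proof
      assume "b = 0"
      with b have "ann a = {0}" by (simp add: ann_compl_def ann_zero)
      with a show False by (auto simp: G_verts_def ann_def mult.commute)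
    qed
    moreover have "a \<noteq> 0" using a by (simp add: G_verts_def)
    ultimately have "graph_perp G_verts G_edges a b" using b by (simp add: graph_perp_iff)
    then show "\<exists>b\<in>G_verts. graph_perp G_verts G_edges a b"
      by (auto simp: graph_perp_def)
  qed
qed

text \<open>All complements of \<open>a\<close> have the same annihilator
  \<open>perp R (ann a)\<close>, hence the same neighbours.\<close>

lemma graph_uniquely_complemented_iff:
  "graph_uniquely_complemented (G_verts :: 'a set) G_edges \<longleftrightarrow>
    graph_complemented (G_verts :: 'a set) G_edges"
proof -
  have *: "(v, c) \<in> G_edges"
    if b: "graph_perp G_verts G_edges a b" and c: "graph_perp G_verts G_edges a c"
      and v: "(v, b) \<in> G_edges" for a b c v :: 'a
  proof -
    have "ann b = ann c"
      using b c ann_compl_sym ann_compl_iff_perp unfolding graph_perp_iff by metis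
    moreover have "v * b = 0" "v \<noteq> 0" "v \<in> G_verts"
      using v by (auto simp: G_edges_def G_verts_def)
    ultimately have vc: "v * c = 0" using mem_ann by metis
    then have "v \<noteq> c" using square_zero \<open>v \<noteq> 0\<close> by blast
    with vc \<open>v \<in> G_verts\<close> c show ?thesis
      by (auto simp: G_edges_def graph_perp_def)
  qed
  then show ?thesis
    unfolding graph_uniquely_complemented_def by blast
qed

section \<open>Prime ideals\<close>

lemma prime_mult_zero:
  assumes "prime_ideal R P" "x * y = 0"
  shows "x \<in> P \<or> y \<in> P"
proof -
  obtain a where "a \<in> P" using assms(1) by (auto simp: prime_ideal_def poset_ideal_def)
  then have "0 \<in> P"
    using poset_ideal_down[OF partial_order_Field] zero_least assms(1)
    unfolding prime_ideal_def by blast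
  then have "Under R {x, y} \<subseteq> P" using assms(2) Under_eq_zero[of x y] by simp
  with assms(1) show ?thesis by (simp add: prime_ideal_def Field_R)
qed

text \<open>A prime inside \<open>P\<close> misses the witness \<open>f\<close>, so it must contain
  \<open>x\<close>.\<close>

lemma MinSpecI:
  assumes P: "prime_ideal R P" and "\<And>x. x \<in> P \<Longrightarrow> \<exists>f. f \<notin> P \<and> x * f = 0"
  shows "P \<in> MinSpec R"
  using assms prime_mult_zero unfolding MinSpec_def Spec_def by blast

text \<open>The prime is the complement of a maximal multiplicatively closed extension of
  \<open>F0\<close> avoiding \<open>0\<close>. The final clause records that each of its elements is
  killed by an element outside it.\<close>

lemma ex_MinSpec_disjoint:
  assumes closed: "\<And>f g. f \<in> F0 \<Longrightarrow> g \<in> F0 \<Longrightarrow> f * g \<in> F0" and nz: "0 \<notin> F0" and ne: "F0 \<noteq> {}"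
  shows "\<exists>P. P \<in> MinSpec R \<and> P \<inter> F0 = {} \<and> (\<forall>x\<in>P. \<exists>f. f \<notin> P \<and> x * f = 0)"
proof -
  define \<F> where "\<F> = {F. F0 \<subseteq> F \<and> 0 \<notin> F \<and> (\<forall>f\<in>F. \<forall>g\<in>F. f * g \<in> F)}"
  have "F0 \<in> \<F>" using closed nz by (auto simp: \<F>_def)
  have "\<exists>F\<in>\<F>. \<forall>X\<in>\<F>. F \<subseteq> X \<longrightarrow> X = F"
  proof (rule subset_Zorn_nonempty)
    show "\<F> \<noteq> {}" using \<open>F0 \<in> \<F>\<close> by blast
    fix C assume C: "C \<noteq> {}" "subset.chain \<F> C"
    then have C': "C \<subseteq> \<F>" and lin: "\<And>X Y. X \<in> C \<Longrightarrow> Y \<in> C \<Longrightarrow> X \<subseteq> Y \<or> Y \<subseteq> X"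
      by (auto simp: subset_chain_def)
    have "f * g \<in> \<Union>C" if fg: "f \<in> \<Union>C" "g \<in> \<Union>C" for f g
    proof -
      obtain X Y where XY: "X \<in> C" "f \<in> X" "Y \<in> C" "g \<in> Y" using fg by blast
      with lin have "\<exists>Z\<in>C. f \<in> Z \<and> g \<in> Z" by blast
      with C' show ?thesis unfolding \<F>_def by blast
    qed
    moreover have "F0 \<subseteq> \<Union>C" "0 \<notin> \<Union>C" using C(1) C' unfolding \<F>_def by blast+
    ultimately show "\<Union>C \<in> \<F>" unfolding \<F>_def by blast
  qed
  then obtain F where F: "F \<in> \<F>" and maximal: "\<And>X. X \<in> \<F> \<Longrightarrow> F \<subseteq> X \<Longrightarrow> X = F" by blast
  have F0F: "F0 \<subseteq> F" and zF: "0 \<notin> F" and mF: "\<And>f g. f \<in> F \<Longrightarrow> g \<in> F \<Longrightarrow> f * g \<in> F"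
    using F by (auto simp: \<F>_def)
  have saturated: "u \<in> F" if f: "f \<in> F" and sub: "ann u \<subseteq> ann f" for u f
  proof -
    define X where "X = {v. \<exists>g\<in>F. ann v \<subseteq> ann g}"
    have "v * w \<in> X" if vw: "v \<in> X" "w \<in> X" for v w
    proof -
      obtain g h where gh: "g \<in> F" "ann v \<subseteq> ann g" "h \<in> F" "ann w \<subseteq> ann h"
        using vw by (auto simp: X_def)
      then have "ann (v * w) \<subseteq> ann (g * h)"
        using ann_subset_ann_mult[of g h] by (intro ann_mult_subset) auto
      with mF gh show ?thesis by (auto simp: X_def)
    qed
    moreover have "F \<subseteq> X" by (auto simp: X_def)
    moreover have "0 \<notin> X"
      using zF ann_UNIV_imp_zero by (auto simp: X_def ann_zero)
    ultimately have "X \<in> \<F>" using F0F by (auto simp: \<F>_def)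
    with maximal \<open>F \<subseteq> X\<close> have "X = F" by blast
    with f sub show ?thesis by (auto simp: X_def)
  qed
  have killed: "\<exists>f\<in>F. x * f = 0" if "x \<notin> F" for x
  proof (rule ccontr)
    assume nk: "\<not> ?thesis"
    \<comment> \<open>\<open>X\<close> extends \<open>F\<close> by \<open>x\<close>. It avoids
      \<open>0\<close> because no \<open>x * g\<close> with \<open>g\<close> in \<open>F\<close>
      vanishes, so maximality forces \<open>x\<close> into \<open>F\<close>.\<close>
    define X where "X = {v. \<exists>g\<in>F. ann v \<subseteq> ann (x * g)}"
    have "v * w \<in> X" if vw: "v \<in> X" "w \<in> X" for v w
    proof -
      obtain g h where gh: "g \<in> F" "ann v \<subseteq> ann (x * g)" "h \<in> F" "ann w \<subseteq> ann (x * h)"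
        using vw by (auto simp: X_def)
      have "ann (x * g) \<subseteq> ann (x * (g * h))" "ann (x * h) \<subseteq> ann (x * (g * h))"
        using ann_subset_ann_mult[of "x * g" h] ann_subset_ann_mult[of "x * h" g]
        by (auto simp: ac_simps)
      with gh have "ann (v * w) \<subseteq> ann (x * (g * h))" by (intro ann_mult_subset) auto
      with mF gh show ?thesis by (auto simp: X_def)
    qed
    moreover have "F \<subseteq> X"
      using ann_subset_ann_mult[of x] by (auto simp: X_def)
    moreover have "0 \<notin> X"
      using nk ann_UNIV_imp_zero by (auto simp: X_def ann_zero)
    ultimately have "X \<in> \<F>" using F0F by (auto simp: \<F>_def)
    with maximal \<open>F \<subseteq> X\<close> have "X = F" by blast
    moreover obtain f where "f \<in> F" using ne F0F by blast
    then have "x \<in> X" using ann_subset_ann_mult[of x f] by (auto simp: X_def)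
    ultimately show False using that by blast
  qed
  have in_compl: "x \<notin> F" if "f \<in> F" "x * f = 0" for x f
    using mF zF that by metis
  have "poset_ideal R (- F)"
    unfolding poset_ideal_def
  proof (intro conjI ballI)
    show "- F \<noteq> {}" using zF by blast
    show "- F \<subseteq> Field R" by (simp add: Field_R)
    fix a b assume "a \<in> - F" "b \<in> - F"
    \<comment> \<open>The annihilators of elements of \<open>F\<close> form a directed family:
      \<open>ann (f * g)\<close> contains both \<open>a\<close> and \<open>b\<close>, is an ideal
      and misses \<open>F\<close>.\<close>
    with killed obtain f g where fg: "f \<in> F" "a * f = 0" "g \<in> F" "b * g = 0" by (meson ComplD)
    then have "a \<in> ann (f * g)" "b \<in> ann (f * g)"
      using ann_subset_ann_mult[of f g] by (auto simp: mem_ann)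
    then have "Under R (Above R {a, b}) \<subseteq> ann (f * g)"
      using poset_ideal_ann unfolding poset_ideal_def by blast
    then show "Under R (Above R {a, b}) \<subseteq> - F"
      using in_compl[OF mF[OF fg(1,3)]] by (auto simp: mem_ann)
  qed
  moreover have "x \<notin> F \<or> y \<notin> F" if "Under R {x, y} \<subseteq> - F" for x y
    using factor_or_mult_in_Under[of x y] that mF by blast
  ultimately have "prime_ideal R (- F)"
    using ne F0F by (auto simp: prime_ideal_def Field_R)
  moreover have "\<exists>f. f \<notin> - F \<and> x * f = 0" if "x \<in> - F" for x
    using killed that by auto
  ultimately show ?thesis
    using MinSpecI[of "- F"] F0F by (intro exI[of _ "- F"]) auto
qed

text \<open>The elements whose annihilator lies in \<open>ann u\<close> form a multiplicatively
  closed set that contains \<open>u\<close> and avoids \<open>0\<close>.\<close>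

lemma ex_MinSpec_not_mem:
  assumes "u \<noteq> 0"
  shows "\<exists>P\<in>MinSpec R. u \<notin> P"
proof -
  let ?F = "{f. ann f \<subseteq> ann u}"
  have "\<exists>P. P \<in> MinSpec R \<and> P \<inter> ?F = {} \<and> (\<forall>x\<in>P. \<exists>f. f \<notin> P \<and> x * f = 0)"
    using ann_mult_subset ann_UNIV_imp_zero[of u] assms
    by (intro ex_MinSpec_disjoint) (auto simp: ann_zero top.extremum_unique)
  then show ?thesis by blast
qed

lemma MinSpec_prime: "P \<in> MinSpec R \<Longrightarrow> prime_ideal R P"
  by (simp add: MinSpec_def Spec_def)

text \<open>The Zorn construction, applied to a set containing the complement of \<open>P\<close>,
  gives a minimal prime inside \<open>P\<close>, hence \<open>P\<close> itself; so each
  \<open>x\<close> in \<open>P\<close> is killed from outside \<open>P\<close>. The converse is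
  primeness.\<close>

lemma MinSpec_mem_iff:
  assumes P: "P \<in> MinSpec R"
  shows "x \<in> P \<longleftrightarrow> \<not> ann x \<subseteq> P"
proof
  assume x: "x \<in> P"
  text \<open>Multiplicatively closed because the complement of a prime ideal is down-directed.\<close>
  let ?F = "{u. \<exists>z. z \<notin> P \<and> ann u \<subseteq> ann z}"
  have prime: "prime_ideal R P" using P by (rule MinSpec_prime)
  have "f * g \<in> ?F" if fg: "f \<in> ?F" "g \<in> ?F" for f g
  proof -
    obtain z w where zw: "z \<notin> P" "ann f \<subseteq> ann z" "w \<notin> P" "ann g \<subseteq> ann w" using fg by blast
    then obtain t where t: "t \<in> Under R {z, w}" "t \<notin> P"
      using prime unfolding prime_ideal_def Field_R by blast
    then have "ann z \<subseteq> ann t" "ann w \<subseteq> ann t" using order_ann by (auto simp: Under_def)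
    with zw t ann_mult_subset[of f t g] show ?thesis by blast
  qed
  moreover have "0 \<notin> ?F"
    using prime_mult_zero[OF prime, of 0 0] ann_UNIV_imp_zero by (auto simp: ann_zero)
  moreover have "?F \<noteq> {}" using prime by (auto simp: prime_ideal_def Field_R)
  ultimately obtain Q where Q: "Q \<in> MinSpec R" "Q \<inter> ?F = {}" "\<forall>x\<in>Q. \<exists>f. f \<notin> Q \<and> x * f = 0"
    using ex_MinSpec_disjoint[of ?F] by blast
  then have "Q \<subseteq> P" by blast
  with P Q(1) have "Q = P" by (simp add: MinSpec_def)
  with Q(3) x show "\<not> ann x \<subseteq> P" by (metis mem_ann mult.commute subsetD)
next
  assume "\<not> ann x \<subseteq> P"
  then show "x \<in> P" using prime_mult_zero[OF MinSpec_prime[OF P]] by (meson mem_ann subsetI)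
qed

text \<open>Primeness is stated with lower bounds; it transfers to products because membership in a
  minimal prime depends only on the annihilator.\<close>

lemma MinSpec_mult_mem_iff:
  assumes P: "P \<in> MinSpec R"
  shows "x * y \<in> P \<longleftrightarrow> x \<in> P \<or> y \<in> P"
proof
  assume xy: "x * y \<in> P"
  show "x \<in> P \<or> y \<in> P"
  proof (rule ccontr)
    assume "\<not> (x \<in> P \<or> y \<in> P)"
    then obtain t where t: "t \<in> Under R {x, y}" "t \<notin> P"
      using MinSpec_prime[OF P] unfolding prime_ideal_def Field_R by blast
    then have "ann x \<subseteq> ann t" "ann y \<subseteq> ann t" using order_ann by (auto simp: Under_def)
    then have "ann (x * y) \<subseteq> ann t" by (rule ann_mult_subset)
    with t(2) xy show False using MinSpec_mem_iff[OF P] by blast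
  qed
next
  assume "x \<in> P \<or> y \<in> P"
  then show "x * y \<in> P"
    using MinSpec_mem_iff[OF P] ann_subset_ann_mult[of x y] by blast
qed

text \<open>A minimal prime contains \<open>ann x\<close> iff it misses \<open>x\<close>, so the
  equation says that each minimal prime contains exactly one of \<open>x\<close> and
  \<open>y\<close>. As minimal primes intersect in \<open>0\<close>, this amounts to
  complementarity.\<close>

lemma V_min_eq_iff: "V_min R y = V_min_perp R x \<longleftrightarrow> ann_compl x y"
proof -
  have "V_min R y = V_min_perp R x \<longleftrightarrow> (\<forall>P\<in>MinSpec R. y \<in> P \<longleftrightarrow> x \<notin> P)"
    using MinSpec_mem_iff[of _ x]
    by (auto simp: V_min_def V_min_perp_def V_def MinSpec_def perp_singleton)
  also have "\<dots> \<longleftrightarrow> ann_compl x y"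
  proof
    assume *: "\<forall>P\<in>MinSpec R. y \<in> P \<longleftrightarrow> x \<notin> P"
    then have "x * y \<in> P" if "P \<in> MinSpec R" for P
      using MinSpec_mult_mem_iff[OF that] that by blast
    then have "x * y = 0" using ex_MinSpec_not_mem by blast
    moreover have "z = 0" if z: "z * x = 0" "z * y = 0" for z
    proof -
      have "z \<in> P" if P: "P \<in> MinSpec R" for P
        using prime_mult_zero[OF MinSpec_prime[OF P] z(1)]
          prime_mult_zero[OF MinSpec_prime[OF P] z(2)] * P by blast
      then show ?thesis using ex_MinSpec_not_mem by blast
    qed
    ultimately show "ann_compl x y" by (auto simp: ann_compl_def mem_ann)
  next
    assume c: "ann_compl x y"
    show "\<forall>P\<in>MinSpec R. y \<in> P \<longleftrightarrow> x \<notin> P"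
    proof
      fix P assume P: "P \<in> MinSpec R"
      note prime = MinSpec_prime[OF P]
      have "False" if xy: "x \<in> P" "y \<in> P"
      proof -
        obtain f g where fg: "f \<notin> P" "f * x = 0" "g \<notin> P" "g * y = 0"
          using MinSpec_mem_iff[OF P] xy by (auto simp: mem_ann)
        then have "f * g \<in> ann x \<inter> ann y"
          using ann_subset_ann_mult[of f g] by (auto simp: mem_ann_comm mem_ann mult.commute)
        with c have "f * g = 0" by (simp add: ann_compl_def)
        with fg prime_mult_zero[OF prime] show False by blast
      qed
      moreover have "x \<in> P \<or> y \<in> P"
        using prime_mult_zero[OF prime] c by (simp add: ann_compl_def)
      ultimately show "y \<in> P \<longleftrightarrow> x \<notin> P" by blast
    qed
  qed
  finally show ?thesis .
qed

section \<open>The Zariski topology\<close>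

lemma topspace: "topspace (zariski R) = Spec R"
  using zero_least partial_order by (intro topspace_zariski) (auto simp: Field_R)

lemma openin_iff: "openin (zariski R) U \<longleftrightarrow> (\<exists>I. poset_ideal R I \<and> U = (\<Union>a\<in>I. D R a))"
proof -
  have "openin (zariski R) U \<longleftrightarrow> (\<exists>I. poset_ideal R I \<and> U = Spec R - V_ideal R I)"
    unfolding zariski_def
    using istopology_zariski[OF partial_order_Field] zero_least
    by (simp add: topology_inverse' Field_R)
  moreover have "Spec R - V_ideal R I = (\<Union>a\<in>I. D R a)" for I
    by (auto simp: V_ideal_def D_def)
  ultimately show ?thesis by simp
qed

text \<open>Primes are down-closed, so \<open>D\<close> is monotone and \<open>D R a\<close> is the
  union over the principal ideal of \<open>a\<close>.\<close>

lemma openin_D: "openin (zariski R) (D R a)"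
proof -
  have "D R b \<subseteq> D R a" if "(b, a) \<in> R" for b
    using poset_ideal_down[OF partial_order_Field] that
    by (auto simp: D_def V_def Spec_def prime_ideal_def)
  then have "D R a = (\<Union>b\<in>under R a. D R b)"
    using R_refl by (auto simp: under_def)
  with poset_ideal_under show ?thesis unfolding openin_iff by blast
qed

text \<open>The sets \<open>D R a\<close> form a base of the topology, so closure can be tested on
  them.\<close>

lemma closure_of_iff:
  "P \<in> zariski R closure_of U \<longleftrightarrow> P \<in> Spec R \<and> (\<forall>a. a \<notin> P \<longrightarrow> U \<inter> D R a \<noteq> {})"
proof -
  have basis: "\<exists>a. P \<in> D R a \<and> D R a \<subseteq> T" if "openin (zariski R) T" "P \<in> T" for T
    using that unfolding openin_iff by blast
  have "(\<forall>T. P \<in> T \<and> openin (zariski R) T \<longrightarrow> (\<exists>Q. Q \<in> U \<and> Q \<in> T))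
      \<longleftrightarrow> (\<forall>a. P \<in> D R a \<longrightarrow> U \<inter> D R a \<noteq> {})" (is "?L \<longleftrightarrow> ?R")
  proof
    assume ?L then show ?R using openin_D by blast
  next
    assume ?R then show ?L using basis by (meson disjoint_iff subsetD)
  qed
  then have "P \<in> zariski R closure_of U \<longleftrightarrow> P \<in> Spec R \<and> (\<forall>a. P \<in> D R a \<longrightarrow> U \<inter> D R a \<noteq> {})"
    by (simp add: in_closure_of topspace)
  then show ?thesis by (auto simp: D_def V_def)
qed

text \<open>A non-zero product is missed by some minimal prime, which then misses both
  factors.\<close>

lemma D_inter_empty_iff: "D R a \<inter> D R b = {} \<longleftrightarrow> a * b = 0"
proof
  assume e: "D R a \<inter> D R b = {}"
  show "a * b = 0"
  proof (rule ccontr)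
    assume "a * b \<noteq> 0"
    then obtain P where P: "P \<in> MinSpec R" "a * b \<notin> P" using ex_MinSpec_not_mem by blast
    then have "P \<in> D R a \<inter> D R b"
      using MinSpec_mult_mem_iff by (auto simp: D_def V_def MinSpec_def)
    with e show False by blast
  qed
next
  assume "a * b = 0"
  then show "D R a \<inter> D R b = {}"
    using prime_mult_zero by (auto simp: D_def V_def Spec_def)
qed

text \<open>A basic open set \<open>D R a\<close> lies in \<open>V R x\<close> iff it is disjoint
  from \<open>D R x\<close>, that is, iff \<open>a * x = 0\<close>.\<close>

lemma interior_of_V: "zariski R interior_of V R x = (\<Union>a\<in>ann x. D R a)"
proof
  have sub: "D R a \<subseteq> V R x \<longleftrightarrow> a \<in> ann x" for a
    using D_inter_empty_iff[of a x] by (auto simp: mem_ann D_def V_def)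
  show "zariski R interior_of V R x \<subseteq> (\<Union>a\<in>ann x. D R a)"
    using sub unfolding interior_of_def openin_iff by blast
  show "(\<Union>a\<in>ann x. D R a) \<subseteq> zariski R interior_of V R x"
    using sub openin_D by (intro interior_of_maximal openin_Union) auto
qed

text \<open>The elements \<open>b\<close> whose \<open>D R b\<close> misses the interior are those
  killing all of \<open>ann x\<close>; a prime is in the closure iff it contains them all.\<close>

lemma closure_interior_V:
  "zariski R closure_of (zariski R interior_of V R x) = {P \<in> Spec R. perp R (ann x) \<subseteq> P}"
proof -
  have "(\<Union>a\<in>ann x. D R a) \<inter> D R b = {} \<longleftrightarrow> b \<in> perp R (ann x)" for b
    using D_inter_empty_iff by (auto simp: perp_eq)
  then show ?thesis unfolding interior_of_V by (auto simp: closure_of_iff)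
qed

lemma closure_D: "zariski R closure_of D R y = {P \<in> Spec R. ann y \<subseteq> P}"
  using D_inter_empty_iff[of y] by (auto simp: closure_of_iff subset_iff mem_ann mult.commute)

text \<open>A non-zero \<open>z\<close> in both annihilators is missed by a minimal prime, which
  contains \<open>perp R (ann x)\<close> but not \<open>ann y\<close>, so it separates the closures.
  For a complement, these two sets coincide.\<close>

lemma closure_interior_V_eq_iff:
  assumes "y \<in> ann x"
  shows "zariski R closure_of (zariski R interior_of V R x) = zariski R closure_of D R y
    \<longleftrightarrow> ann_compl x y"
proof
  assume "zariski R closure_of (zariski R interior_of V R x) = zariski R closure_of D R y"
  then have eq: "perp R (ann x) \<subseteq> P \<longleftrightarrow> ann y \<subseteq> P" if "prime_ideal R P" for P
    using that unfolding closure_interior_V closure_D Spec_def by blast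
  have "z = 0" if z: "z \<in> ann x" "z \<in> ann y" for z
  proof (rule ccontr)
    assume "z \<noteq> 0"
    then obtain P where P: "P \<in> MinSpec R" "z \<notin> P" using ex_MinSpec_not_mem by blast
    note prime = MinSpec_prime[OF P(1)]
    have "perp R (ann x) \<subseteq> P"
      using z(1) P(2) prime_mult_zero[OF prime] by (auto simp: perp_eq)
    moreover have "\<not> ann y \<subseteq> P"
      using z(2) P(2) by blast
    ultimately show False using eq[OF prime] by blast
  qed
  with assms show "ann_compl x y"
    using zero_in_ann by (auto simp: ann_compl_def mem_ann mult.commute)
next
  assume "ann_compl x y"
  then have "ann y = perp R (ann x)" using ann_compl_sym ann_compl_iff_perp by blast
  then show "zariski R closure_of (zariski R interior_of V R x) = zariski R closure_of D R y"
    by (simp add: closure_interior_V closure_D)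
qed

theorem all_equivalent_ann_compl:
  "all_equivalent
    [ quasi_complemented R,
      (\<forall>x. \<exists>y. perp R {x} = perp R (perp R {y})),
      (\<forall>x. \<exists>y\<in>perp R {x}. perp R {x} \<inter> perp R {y} = {0}),
      (\<forall>x. \<exists>y\<in>perp R {x}.
         zariski R closure_of (zariski R interior_of V R x) = zariski R closure_of D R y),
      (\<forall>x. \<exists>y. V_min R y = V_min_perp R x),
      graph_complemented (Gamma_verts R) (Gamma_edges R),
      graph_uniquely_complemented (Gamma_verts R) (Gamma_edges R),
      graph_complemented (G_verts :: 'a set) G_edges,
      graph_uniquely_complemented (G_verts :: 'a set) G_edges,
      weakly_quasi_complemented R ]"
proof -
  have compl_mem: "ann_compl x y \<longleftrightarrow> y \<in> ann x \<and> ann x \<inter> ann y = {0}" for x y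
    by (simp add: ann_compl_def mem_ann mult.commute)
  \<comment> \<open>In this condition and the third, the bound \<open>y\<close> in
    \<open>ann x\<close> supplies the clause \<open>x * y = 0\<close> of a complement.\<close>
  have 4: "(\<exists>y\<in>ann x.
         zariski R closure_of (zariski R interior_of V R x) = zariski R closure_of D R y)
      \<longleftrightarrow> (\<exists>y. ann_compl x y)" for x
    using closure_interior_V_eq_iff compl_mem by blast
  have 3: "(\<exists>y\<in>ann x. ann x \<inter> ann y = {0}) \<longleftrightarrow> (\<exists>y. ann_compl x y)" for x
    using compl_mem by blast
  show ?thesis
    unfolding all_equivalent_def Gamma_verts_eq Gamma_edges_eq perp_singleton
      quasi_complemented_iff weakly_quasi_complemented_iff graph_uniquely_complemented_iff
      graph_complemented_iff V_min_eq_iff 3 4 ann_compl_iff_perp[symmetric]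
    by simp
qed

end

theorem theorem3p11:
  fixes W :: "'a::{comm_monoid_mult,mult_zero,zero_neq_one} set \<Rightarrow> 'a rel"
    and R :: "'a rel"
  assumes reduced: "\<And>(x::'a) n. x ^ n = 0 \<Longrightarrow> x = 0"
    and well_orders: "\<And>r::'a. well_order_on (ann_class r) (W (ann_class r))"
    and R: "R = ann_order W"
    and ac: "\<And>x y::'a. \<exists>z. ann x \<inter> ann y = ann z"
  shows "all_equivalent
    [ quasi_complemented R,
      (\<forall>x. \<exists>y. perp R {x} = perp R (perp R {y})),
      (\<forall>x. \<exists>y\<in>perp R {x}. perp R {x} \<inter> perp R {y} = {0}),
      (\<forall>x. \<exists>y\<in>perp R {x}.
         zariski R closure_of (zariski R interior_of V R x) = zariski R closure_of D R y),
      (\<forall>x. \<exists>y. V_min R y = V_min_perp R x),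
      graph_complemented (Gamma_verts R) (Gamma_edges R),
      graph_uniquely_complemented (Gamma_verts R) (Gamma_edges R),
      graph_complemented (G_verts :: 'a set) G_edges,
      graph_uniquely_complemented (G_verts :: 'a set) G_edges,
      weakly_quasi_complemented R ]"
proof -
  have "reduced_semigroup_order R"
  proof
    show "x = 0" if "x * x = 0" for x :: 'a
      using reduced[of x 2] that by (simp add: power2_eq_square)
    show "partial_order_on UNIV R"
      unfolding R by (rule ann_order_partial_order[OF well_orders])
    show "(x, y) \<in> R \<or> (y, x) \<in> R" if "ann x = ann y" for x y
    proof -
      have "ann_class x = ann_class y" using that by (simp add: ann_class_def)
      moreover have "x \<in> ann_class x" "y \<in> ann_class x"
        using that by (auto simp: ann_class_def)
      \<comment> \<open>Reflexivity covers the case \<open>x = y\<close>, since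
        \<open>total_on\<close> compares distinct elements only.\<close>
      moreover have "(x, x) \<in> R"
        using ann_order_partial_order[OF well_orders] by (simp add: R order_on_defs refl_on_def)
      ultimately show ?thesis
        using well_orders[of x] that
        by (cases "x = y") (auto simp: R ann_order_def order_on_defs total_on_def)
    qed
  qed (use ac in \<open>auto simp: R ann_order_def\<close>)
  then show ?thesis
    by (rule reduced_semigroup_order.all_equivalent_ann_compl)
qed

end
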